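(* Let $m,n,k$ be nonnegative integers with $m+n>2k$. If $k>0$, then $$\sum_{l=0}^{m+n-2k}\binom{n+m-2k}{l}(-1)^l\xi_{l+2k,q}=q^2\sum_{l=0}^{2k}\binom{2k}{l}(-1)^{l+2k}\xi_{n+m-l,1/q}.$$ Moreover (case $k=0$, i.e. $m+n>0$), $$\sum_{l=0}^{m+n}\binom{n+m}{l}(-1)^l\xi_{l,q}=q^2\xi_{n+m,1/q}+[2]_q.$$
   Context: Let $p$ be an odd prime, $\mathbb{C}_p$ the completion of an algebraic closure of $\mathbb{Q}_p$, and $q\in\mathbb{C}_p$ with $|1-q|_p<1$ (then also $|1-q^{-1}|_p<1$). Put $[2]_q=1+q$. For $Q\in\{q,q^{-1}\}$ the $Q$-Euler numbers $\xi_{n,Q}$ are defined by $\xi_{0,Q}=1$ and, for $n\ge 1$, $Q\sum_{l=0}^{n}\binom{n}{l}Q^l\xi_{l,Q}+\xi_{n,Q}=0$; $\xi_{n,1/q}$ denotes these numbers for $Q=q^{-1}$. *)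

theory Defs
  imports
    "HOL-Analysis.Analysis"
    "HOL-Computational_Algebra.Computational_Algebra"
begin

definition padic_abs :: "nat \<Rightarrow> rat \<Rightarrow> real" where
  "padic_abs p x =
     (if x = 0 then 0
      else real p powi (int (multiplicity (int p) (snd (quotient_of x)))
                        - int (multiplicity (int p) (fst (quotient_of x)))))"

definition is_subfield :: "'a::field set \<Rightarrow> bool" where
  "is_subfield F \<longleftrightarrow> 0 \<in> F \<and> 1 \<in> F \<and>
     (\<forall>x\<in>F. \<forall>y\<in>F. x - y \<in> F \<and> x * y \<in> F) \<and> (\<forall>x\<in>F. inverse x \<in> F)"

definition is_algebraic_closure_of :: "'a::field set \<Rightarrow> 'a set \<Rightarrow> bool" where
  "is_algebraic_closure_of A F \<longleftrightarrow>
     is_subfield F \<and> is_subfield A \<and> F \<subseteq> A \<and>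
     (\<forall>x\<in>A. \<exists>f. f \<noteq> 0 \<and> (\<forall>i. coeff f i \<in> F) \<and> poly f x = 0) \<and>
     (\<forall>f. degree f > 0 \<longrightarrow> (\<forall>i. coeff f i \<in> A) \<longrightarrow> (\<exists>x\<in>A. poly f x = 0))"

definition is_completion_of :: "('a::field \<Rightarrow> real) \<Rightarrow> 'a set \<Rightarrow> 'a set \<Rightarrow> bool" where
  "is_completion_of av K F \<longleftrightarrow>
     is_subfield F \<and> is_subfield K \<and> F \<subseteq> K \<and>
     Metric_space.mcomplete K (\<lambda>x y. av (x - y)) \<and>
     Metric_space.mtopology K (\<lambda>x y. av (x - y)) closure_of F = K"

text \<open>
  Up to isometric isomorphism, the only model of the following locale is
  the field \<open>\<complex>\<^sub>p\<close> with its \<open>p\<close>-adic absolute value: \<open>Qp\<close> is the completion of the rationals,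
  \<open>Qp_bar\<close> an algebraic closure of \<open>Qp\<close>, and the whole type is the completion of \<open>Qp_bar\<close>.
\<close>

locale padic_complex_field =
  fixes p :: nat and av :: "'a::field_char_0 \<Rightarrow> real"
  assumes prime_p: "prime p"
    and av_nonneg: "av x \<ge> 0"
    and av_eq_0_iff: "av x = 0 \<longleftrightarrow> x = 0"
    and av_mult: "av (x * y) = av x * av y"
    and av_add_le: "av (x + y) \<le> max (av x) (av y)"
    and av_of_rat: "av (of_rat r) = padic_abs p r"
    and completion_tower:
      "\<exists>Qp Qp_bar. is_completion_of av Qp \<rat> \<and> is_algebraic_closure_of Qp_bar Qp \<and>
                   is_completion_of av UNIV Qp_bar"

definition is_Q_Euler_seq :: "'a::field \<Rightarrow> (nat \<Rightarrow> 'a) \<Rightarrow> bool" where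
  "is_Q_Euler_seq Q x \<longleftrightarrow> x 0 = 1 \<and>
     (\<forall>n\<ge>1. Q * (\<Sum>l=0..n. of_nat (n choose l) * Q ^ l * x l) + x n = 0)"

text \<open>
  The recurrence determines the sequence as long as \<open>1 + Q ^ (n + 1) \<noteq> 0\<close> for all \<open>n \<ge> 1\<close>; see
  \<open>ex1_Q_Euler_seq\<close> and \<open>padic_complex_field.ex1_Q_Euler_seq_padic\<close> below.
\<close>

definition Q_Euler :: "'a::field \<Rightarrow> nat \<Rightarrow> 'a" where
  "Q_Euler Q = (THE x. is_Q_Euler_seq Q x)"

lemma is_Q_Euler_seq_iff:
  "is_Q_Euler_seq Q x \<longleftrightarrow> x 0 = 1 \<and>
     (\<forall>n\<ge>1. (1 + Q ^ (n + 1)) * x n = - Q * (\<Sum>l<n. of_nat (n choose l) * Q ^ l * x l))"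
proof -
  have "Q * (\<Sum>l=0..n. of_nat (n choose l) * Q ^ l * x l) + x n
      = Q * (\<Sum>l<n. of_nat (n choose l) * Q ^ l * x l) + (1 + Q ^ (n + 1)) * x n" for n
    by (simp add: atLeast0AtMost flip: lessThan_Suc_atMost) (simp add: algebra_simps)
  then show ?thesis
    unfolding is_Q_Euler_seq_def by (simp add: add_eq_0_iff)
qed

fun Q_Euler_rec :: "'a::field \<Rightarrow> nat \<Rightarrow> 'a" where
  "Q_Euler_rec Q n =
     (if n = 0 then 1
      else - Q * (\<Sum>l<n. of_nat (n choose l) * Q ^ l * Q_Euler_rec Q l) / (1 + Q ^ (n + 1)))"

declare Q_Euler_rec.simps [simp del]

lemma ex1_Q_Euler_seq:
  fixes Q :: "'a::field"
  assumes nz: "\<And>n. n \<ge> 1 \<Longrightarrow> 1 + Q ^ (n + 1) \<noteq> 0"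
  shows "\<exists>!x. is_Q_Euler_seq Q x"
proof (rule ex1I[of _ "Q_Euler_rec Q"])
  have "(1 + Q ^ (n + 1)) * Q_Euler_rec Q n
      = - Q * (\<Sum>l<n. of_nat (n choose l) * Q ^ l * Q_Euler_rec Q l)" if "n \<ge> 1" for n
    using nz[OF that] that by (subst Q_Euler_rec.simps) (simp del: power_Suc)
  then show "is_Q_Euler_seq Q (Q_Euler_rec Q)"
    unfolding is_Q_Euler_seq_iff by (simp add: Q_Euler_rec.simps[of Q 0])
next
  fix x assume x: "is_Q_Euler_seq Q x"
  have "x n = Q_Euler_rec Q n" for n
  proof (induction n rule: less_induct)
    case (less n)
    show ?case
    proof (cases "n = 0")
      case True
      then show ?thesis using x by (simp add: is_Q_Euler_seq_def Q_Euler_rec.simps)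
    next
      case False
      then have n: "n \<ge> 1" by simp
      have "(1 + Q ^ (n + 1)) * x n = - Q * (\<Sum>l<n. of_nat (n choose l) * Q ^ l * x l)"
        using x n unfolding is_Q_Euler_seq_iff by blast
      also have "(\<Sum>l<n. of_nat (n choose l) * Q ^ l * x l)
          = (\<Sum>l<n. of_nat (n choose l) * Q ^ l * Q_Euler_rec Q l)"
        by (rule sum.cong) (simp_all add: less)
      finally have "x n = - Q * (\<Sum>l<n. of_nat (n choose l) * Q ^ l * Q_Euler_rec Q l)
          / (1 + Q ^ (n + 1))"
        using nz[OF n] by (metis nonzero_mult_div_cancel_left)
      then show ?thesis
        using False by (subst Q_Euler_rec.simps) simp
    qed
  qed
  then show "x = Q_Euler_rec Q" by auto
qed

context padic_complex_field
begin

lemma av_0: "av 0 = 0"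
  by (simp add: av_eq_0_iff)

lemma av_1: "av 1 = 1"
  using av_mult[of 1 1] av_eq_0_iff[of 1] by simp

lemma av_minus: "av (- x) = av x"
proof -
  have "av (-1) * av (-1) = 1" using av_mult[of "-1" "-1"] av_1 by simp
  then have "av (-1) = 1"
    using av_nonneg[of "-1"] by (simp add: square_eq_1_iff)
  then show ?thesis using av_mult[of "-1" x] by simp
qed

lemma av_diff_le: "av (x - y) \<le> max (av x) (av y)"
  using av_add_le[of x "- y"] by (simp add: av_minus)

sublocale Metric_space UNIV "\<lambda>x y. av (x - y)"
proof
  fix x y z :: 'a
  show "0 \<le> av (x - y)" by (rule av_nonneg)
  show "av (x - y) = av (y - x)" using av_minus[of "x - y"] by simp
  show "av (x - y) = 0 \<longleftrightarrow> x = y" by (simp add: av_eq_0_iff)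
  show "av (x - z) \<le> av (x - y) + av (y - z)"
    using av_add_le[of "x - y" "y - z"] av_nonneg[of "x - y"] av_nonneg[of "y - z"] by simp
qed

lemma av_eq_1: assumes "av (1 - q) < 1" shows "av q = 1"
proof (rule antisym)
  show "av q \<le> 1" using av_diff_le[of 1 "1 - q"] assms av_1 by simp
  show "1 \<le> av q" using av_add_le[of "1 - q" q] assms av_1 by simp
qed

lemma av_one_minus_inverse_less:
  assumes "av (1 - q) < 1" shows "av (1 - 1 / q) < 1"
proof -
  have q: "av q = 1" "q \<noteq> 0" using av_eq_1[OF assms] av_0 by auto
  have "av (1 - q) = av q * av (1 - 1 / q)"
    using q(2) av_minus[of "1 - q"] by (simp flip: av_mult add: algebra_simps)
  then show ?thesis using assms q by simp
qed

lemma av_one_minus_power_less: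
  assumes "av (1 - q) < 1" shows "av (1 - q ^ n) < 1"
proof (induction n)
  case 0
  then show ?case by (simp add: av_0)
next
  case (Suc n)
  have "1 - q ^ Suc n = (1 - q) + q * (1 - q ^ n)" by (simp add: algebra_simps)
  then have "av (1 - q ^ Suc n) \<le> max (av (1 - q)) (av q * av (1 - q ^ n))"
    by (metis av_add_le av_mult)
  then show ?case using Suc assms av_eq_1[OF assms] by simp
qed

lemma av_2: assumes "odd p" shows "av 2 = 1"
proof -
  have "\<not> int p dvd 2"
  proof
    assume "int p dvd 2"
    then have "p dvd 2" by presburger
    then have "p \<le> 2" by (rule dvd_imp_le) simp
    then show False using assms prime_ge_2_nat[OF prime_p] by simp
  qed
  then have "multiplicity (int p) 2 = 0" by (rule not_dvd_imp_multiplicity_0)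
  moreover have "quotient_of 2 = (2, 1)" by (rule quotient_of_number(3))
  ultimately have "padic_abs p 2 = 1" by (simp add: padic_abs_def)
  then show ?thesis using av_of_rat[of 2] by simp
qed

lemma ex1_Q_Euler_seq_padic:
  assumes "odd p" "av (1 - Q) < 1"
  shows "\<exists>!x. is_Q_Euler_seq Q x"
proof (rule ex1_Q_Euler_seq, rule notI)
  fix n :: nat
  assume "1 + Q ^ (n + 1) = 0"
  then have "1 - Q ^ (n + 1) = 2" by (metis add.commute add_eq_0_iff2 diff_minus_eq_add one_add_one)
  then show False using av_one_minus_power_less[OF assms(2), of "n + 1"] av_2[OF assms(1)]
    by (metis less_irrefl)
qed

lemma is_Q_Euler_seq_Q_Euler:
  assumes "odd p" "av (1 - Q) < 1"
  shows "is_Q_Euler_seq Q (Q_Euler Q)"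
  unfolding Q_Euler_def by (rule theI'[OF ex1_Q_Euler_seq_padic[OF assms]])

end

end

theory Submission
  imports Defs
begin

text \<open>
  Let \<open>L\<close> be the linear functional on polynomials sending \<open>t ^ n\<close> to the \<open>n\<close>-th \<open>q\<close>-Euler number.
  The recurrence says \<open>q * L (f (q t + 1)) + L f = (1 + q) * f 0\<close> for all polynomials \<open>f\<close>.
  Applying this to \<open>f ((1 - t) / q + 1)\<close> shows that
  \<open>f \<mapsto> (L (f (1 - t)) - (1 + q) * f 1) / q\<^sup>2 + (1 + 1 / q) * f 0\<close> satisfies the functional equation
  for \<open>1 / q\<close>, so by uniqueness it is the functional of the \<open>1 / q\<close>-Euler numbers. Evaluating it at
  \<open>f s = s ^ (n + m - 2 k) * (1 - s) ^ (2 k)\<close> and expanding both sides gives the theorem.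
\<close>

text \<open>The functional \<open>L\<close> of the overview, for an arbitrary sequence
  \<open>x\<close>.\<close>

definition umbral :: "(nat \<Rightarrow> 'a::comm_ring_1) \<Rightarrow> 'a poly \<Rightarrow> 'a" where
  "umbral x f = (\<Sum>i\<le>degree f. coeff f i * x i)"

text \<open>Padding with zero coefficients lets polynomials of different degrees be summed over one
  range.\<close>

lemma umbral_eq_sum: "degree f \<le> d \<Longrightarrow> umbral x f = (\<Sum>i\<le>d. coeff f i * x i)"
  unfolding umbral_def by (rule sum.mono_neutral_left) (auto simp: coeff_eq_0)

lemma umbral_add: "umbral x (f + g) = umbral x f + umbral x g"
  using umbral_eq_sum[of "f + g" "max (degree f) (degree g)" x]
    umbral_eq_sum[of f "max (degree f) (degree g)" x]
    umbral_eq_sum[of g "max (degree f) (degree g)" x]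
  by (simp add: degree_add_le distrib_right sum.distrib)

lemma umbral_smult: "umbral x (smult c f) = c * umbral x f"
  using umbral_eq_sum[of "smult c f" "degree f" x]
  by (simp add: degree_smult_le umbral_def sum_distrib_left mult.assoc)

lemma umbral_sum: "umbral x (\<Sum>i\<in>A. f i) = (\<Sum>i\<in>A. umbral x (f i))"
proof (induction A rule: infinite_finite_induct)
  case (insert i A)
  then show ?case by (simp add: umbral_add)
qed (simp_all add: umbral_def)

lemma umbral_monom: "umbral x (monom c n) = c * x n"
  using umbral_eq_sum[of "monom c n" n x] degree_monom_le[of c n]
  by (simp add: if_distrib[of "\<lambda>u. u * _"] cong: if_cong)

lemma umbral_1: "umbral x 1 = x 0"
  by (simp add: umbral_def)

text \<open>Binomial theorem under the functional; with \<open>a = 1\<close> and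
  \<open>b = -1\<close> it produces both sums of the final identity.\<close>

lemma umbral_monom_mult_linear_power:
  "umbral x (monom 1 j * [:a, b:] ^ n)
     = (\<Sum>l\<le>n. of_nat (n choose l) * a ^ (n - l) * b ^ l * x (l + j))"
proof -
  have "degree ([:a, b:] ^ n) \<le> n"
    using degree_power_le[of "[:a, b:]" n] by (rule order_trans) simp
  then have "[:a, b:] ^ n = (\<Sum>l\<le>n. monom (coeff ([:a, b:] ^ n) l) l)"
    by (rule poly_as_sum_of_monoms'[symmetric])
  also have "\<dots> = (\<Sum>l\<le>n. monom (of_nat (n choose l) * a ^ (n - l) * b ^ l) l)"
    by (simp add: coeff_linear_poly_power ac_simps)
  finally show ?thesis
    by (simp add: sum_distrib_left umbral_sum mult_monom umbral_monom add.commute)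
qed

lemma umbral_linear_power:
  "umbral x ([:a, b:] ^ n) = (\<Sum>l\<le>n. of_nat (n choose l) * a ^ (n - l) * b ^ l * x l)"
  using umbral_monom_mult_linear_power[of x 0] by simp

lemma pcompose_power: "(f ^ n) \<circ>\<^sub>p g = (f \<circ>\<^sub>p g) ^ n"
  for f g :: "'a::comm_ring_1 poly"
  by (induction n) (simp_all add: pcompose_1 pcompose_mult)

lemma pcompose_monom: "monom c n \<circ>\<^sub>p g = smult c (g ^ n)"
  for c :: "'a::comm_ring_1"
proof -
  have "monom c n = smult c ([:0, 1:] ^ n)" by (simp add: monom_altdef)
  then show ?thesis by (simp add: pcompose_smult pcompose_power pcompose_pCons)
qed

lemma poly_eqI_on_monoms:
  fixes F G :: "'a::comm_ring_1 poly \<Rightarrow> 'a"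
  assumes "\<And>f g. F (f + g) = F f + F g" "\<And>f g. G (f + g) = G f + G g"
    and "\<And>c f. F (smult c f) = c * F f" "\<And>c f. G (smult c f) = c * G f"
    and "\<And>n. F (monom 1 n) = G (monom 1 n)"
  shows "F f = G f"
proof -
  have monom: "F (monom c n) = G (monom c n)" for c n
    using assms(3,4)[of c "monom 1 n"] assms(5) by (simp add: smult_monom)
  have "F (\<Sum>i\<in>A. monom (c i) i) = G (\<Sum>i\<in>A. monom (c i) i)" for A and c :: "nat \<Rightarrow> 'a"
  proof (induction A rule: infinite_finite_induct)
    case (insert i A)
    then show ?case by (simp add: assms(1,2) monom)
  \<comment> \<open>Scaling by \<open>0\<close> gives \<open>F 0 = 0 = G 0\<close>, which settles
    empty and infinite \<open>A\<close>.\<close>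
  qed (use assms(3,4)[of 0 0] in simp_all)
  from this[of "coeff f" "{..degree f}"] show ?thesis by (simp add: poly_as_sum_of_monoms)
qed

text \<open>By linearity only powers of the variable matter. For \<open>n >= 1\<close> expanding
  \<open>(1 + Q t) ^ n\<close> gives the recurrence; \<open>n = 0\<close>, which the recurrence
  leaves out, contributes \<open>1 + Q\<close>.\<close>

lemma is_Q_Euler_seq_umbral:
  assumes "is_Q_Euler_seq Q x"
  shows "Q * umbral x (f \<circ>\<^sub>p [:1, Q:]) + umbral x f = (1 + Q) * poly f 0"
proof (rule poly_eqI_on_monoms)
  show "Q * umbral x (monom 1 n \<circ>\<^sub>p [:1, Q:]) + umbral x (monom 1 n)
      = (1 + Q) * poly (monom 1 n) 0" for n
  proof (cases "n = 0")
    case True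
    then show ?thesis using assms
      by (simp add: is_Q_Euler_seq_def pcompose_1 umbral_1)
  next
    case False
    then show ?thesis using assms
      by (simp add: is_Q_Euler_seq_def pcompose_monom umbral_linear_power umbral_monom
          poly_monom atLeast0AtMost)
  qed
qed (simp_all add: pcompose_add pcompose_smult umbral_add umbral_smult algebra_simps)

theorem umbral_reflection:
  fixes q :: "'a::field"
  assumes x: "is_Q_Euler_seq q x" and z: "is_Q_Euler_seq (1 / q) z" and "q \<noteq> 0"
    and unique: "\<exists>!z. is_Q_Euler_seq (1 / q) z"
  shows "umbral x (f \<circ>\<^sub>p [:1, -1:])
       = q\<^sup>2 * umbral z f + (1 + q) * poly f 1 - q * (1 + q) * poly f 0"
proof -
  \<comment> \<open>In the functional equation, subtracting \<open>(1 + q) * poly f 1\<close>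
    cancels the value at \<open>1 + 1 / q\<close>. The multiple of \<open>poly f 0\<close> cancels a
    leftover value at \<open>1\<close> and supplies the new right-hand side.\<close>
  define M where "M f = (umbral x (f \<circ>\<^sub>p [:1, -1:]) - (1 + q) * poly f 1) / q\<^sup>2
      + (1 + 1 / q) * poly f 0" for f
  define z' where "z' n = M (monom 1 n)" for n
  have M: "M f = umbral z' f" for f
  proof (rule poly_eqI_on_monoms)
    show "M (monom 1 n) = umbral z' (monom 1 n)" for n
      by (simp add: umbral_monom z'_def)
  qed (simp_all add: M_def pcompose_add pcompose_smult umbral_add umbral_smult
      add_divide_distrib diff_divide_distrib algebra_simps)
  have fe: "1 / q * M (f \<circ>\<^sub>p [:1, 1 / q:]) + M f = (1 + 1 / q) * poly f 0" for f
  proof -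
    \<comment> \<open>This substitution is \<open>1 + s / q\<close> at \<open>s = 1 - t\<close>, and
      replacing \<open>t\<close> by \<open>1 + q t\<close> turns it into \<open>1 - t\<close>. So
      one instance of the equation for \<open>q\<close> links both terms on the left.\<close>
    let ?g = "f \<circ>\<^sub>p [:1 + 1 / q, - 1 / q:]"
    have "?g \<circ>\<^sub>p [:1, q:] = f \<circ>\<^sub>p [:1, -1:]"
      using \<open>q \<noteq> 0\<close> by (simp add: pcompose_pCons flip: pcompose_assoc)
    with is_Q_Euler_seq_umbral[OF x, of ?g]
    have "umbral x ?g = (1 + q) * poly f (1 + 1 / q) - q * umbral x (f \<circ>\<^sub>p [:1, -1:])"
      by (simp add: poly_pcompose algebra_simps)
    moreover have "(f \<circ>\<^sub>p [:1, 1 / q:]) \<circ>\<^sub>p [:1, -1:] = ?g"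
      by (simp add: pcompose_pCons flip: pcompose_assoc)
    ultimately have "M (f \<circ>\<^sub>p [:1, 1 / q:])
        = - q * umbral x (f \<circ>\<^sub>p [:1, -1:]) / q\<^sup>2 + (1 + 1 / q) * poly f 1"
      by (simp add: M_def poly_pcompose)
    then show ?thesis
      using \<open>q \<noteq> 0\<close> by (simp only: M_def[of f]) (simp add: field_simps power2_eq_square)
  qed
  have "is_Q_Euler_seq (1 / q) z'"
    unfolding is_Q_Euler_seq_def
  proof (intro conjI allI impI)
    show "z' 0 = 1"
      using x \<open>q \<noteq> 0\<close>
      by (simp add: is_Q_Euler_seq_def z'_def M_def pcompose_1 umbral_1 field_simps power2_eq_square)
    fix n :: nat
    assume "n \<ge> 1"
    then show "1 / q * (\<Sum>l=0..n. of_nat (n choose l) * (1 / q) ^ l * z' l) + z' n = 0"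
      using fe[of "monom 1 n"]
      by (simp add: M pcompose_monom umbral_linear_power umbral_monom poly_monom atLeast0AtMost)
  qed
  then have "z = z'" using z unique by blast
  then have "umbral z f = M f" by (simp add: M)
  then show ?thesis
    using \<open>q \<noteq> 0\<close> by (simp only: M_def) (simp add: field_simps power2_eq_square)
qed

theorem theorem8:
  fixes p :: nat and av :: "'a::field_char_0 \<Rightarrow> real" and q :: 'a and m n k :: nat
  assumes "prime p" and "odd p"
    and "padic_complex_field p av"
    and "av (1 - q) < 1"
    and "m + n > 2 * k"
  shows "(k > 0 \<longrightarrow>
           (\<Sum>l=0..m+n-2*k. of_nat ((n+m-2*k) choose l) * (-1)^l * Q_Euler q (l + 2*k))
           = q^2 * (\<Sum>l=0..2*k. of_nat ((2*k) choose l) * (-1)^(l + 2*k) * Q_Euler (1/q) (n + m - l)))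
       \<and> (k = 0 \<longrightarrow>
           (\<Sum>l=0..m+n. of_nat ((n+m) choose l) * (-1)^l * Q_Euler q l)
           = q^2 * Q_Euler (1/q) (n + m) + (1 + q))"
proof -
  interpret padic_complex_field p av by fact
  define N where "N = n + m"
  have N: "m + n = N" "n + m = N" "2 * k < N" using assms(5) by (auto simp: N_def)
  have "q \<noteq> 0" using av_eq_1[OF assms(4)] av_0 by auto
  have q': "av (1 - 1 / q) < 1" by (rule av_one_minus_inverse_less) fact
  \<comment> \<open>Reflection swaps the roles of the two factors, hence of the two
    exponents.\<close>
  let ?g = "monom 1 (N - 2 * k) * [:1, -1:] ^ (2 * k) :: 'a poly"
  have "[:1, -1:] \<circ>\<^sub>p [:1, -1:] = (monom 1 1 :: 'a poly)"
    by (simp add: pcompose_pCons monom_altdef)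
  then have "?g \<circ>\<^sub>p [:1, -1:] = monom 1 (2 * k) * [:1, -1:] ^ (N - 2 * k)"
    by (simp add: pcompose_mult pcompose_monom pcompose_power monom_power mult.commute)
  then have "(\<Sum>l\<le>N - 2 * k. of_nat ((N - 2 * k) choose l) * (-1) ^ l * Q_Euler q (l + 2 * k))
      = umbral (Q_Euler q) (?g \<circ>\<^sub>p [:1, -1:])"
    by (simp add: umbral_monom_mult_linear_power)
  also have "\<dots> = q\<^sup>2 * umbral (Q_Euler (1 / q)) ?g + (1 + q) * poly ?g 1 - q * (1 + q) * poly ?g 0"
    using is_Q_Euler_seq_Q_Euler[OF assms(2,4)] is_Q_Euler_seq_Q_Euler[OF assms(2) q']
      \<open>q \<noteq> 0\<close> ex1_Q_Euler_seq_padic[OF assms(2) q']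
    by (rule umbral_reflection)
  \<comment> \<open>The strict inequality \<open>2 * k < N\<close> makes the exponent of the first
    factor positive.\<close>
  also have "poly ?g 0 = 0" using N by (simp add: poly_monom)
  \<comment> \<open>The factor \<open>0 ^ (2 * k)\<close> decides whether the extra term
    \<open>1 + q\<close> survives: this separates the two cases.\<close>
  also have "poly ?g 1 = (if k = 0 then 1 else 0)" by (simp add: poly_monom)
  also have "umbral (Q_Euler (1 / q)) ?g
      = (\<Sum>l\<le>2 * k. of_nat ((2 * k) choose l) * (-1) ^ l * Q_Euler (1 / q) (l + (N - 2 * k)))"
    by (simp add: umbral_monom_mult_linear_power)
  \<comment> \<open>Reversing the order of summation keeps the sign because \<open>2 * k\<close> is
    even.\<close>
  also have "\<dots> = (\<Sum>l\<le>2 * k. of_nat ((2 * k) choose l) * (-1) ^ (l + 2 * k) * Q_Euler (1 / q) (N - l))"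
    by (rule sum.reindex_bij_witness[of _ "\<lambda>l. 2 * k - l" "\<lambda>l. 2 * k - l"])
      (use N in \<open>auto simp: binomial_symmetric[symmetric] power_add minus_one_power_iff add.commute\<close>)
  finally show ?thesis
    by (auto simp: N atLeast0AtMost)
qed

end
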